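(* Let $\lambda\in\mathbb{C}$ with $\lambda\neq1$, and let $(M_n^*(x|\lambda))_{n\ge0}$ be the associated sequence for the delta series $\frac{e^t-1}{e^t-\lambda}$, i.e. $M_n^*(x|\lambda)\sim\left(1,\frac{e^t-1}{e^t-\lambda}\right)$. Then for every $n\in\mathbb{N}$ (that is, $n\ge1$), $$M_n^*(x|\lambda)=\sum_{l=0}^{n}\binom{n}{l}(-\lambda)^{n-l}\,x\,B_{n-1}^{(n)}(x+l).$$
   Context: Let $\mathbb{P}=\mathbb{C}[x]$ and let $\mathcal{F}$ be the algebra of formal power series in $t$ over $\mathbb{C}$. A series $f(t)=\sum_{k\ge0}\frac{a_k}{k!}t^k\in\mathcal{F}$ acts as a linear functional on $\mathbb{P}$ by $\langle f(t)\mid x^n\rangle=a_n$ for $n\ge0$. A delta series is a series with zero constant term and nonzero coefficient of $t$; an invertible series is one with nonzero constant term. For an invertible series $g(t)$ and a delta series $f(t)$ there is a unique sequence of polynomials $S_n(x)$ ($n\ge0$) with $\langle g(t)f(t)^k\mid S_n(x)\rangle=n!\,\delta_{n,k}$ for all $n,k\ge0$; it is called the Sheffer sequence for $(g(t),f(t))$, written $S_n(x)\sim(g(t),f(t))$. If $g(t)=1$, it is called the associated sequence for $f(t)$. The Bernoulli polynomials of order $\alpha$ are defined by $\left(\frac{t}{e^t-1}\right)^{\alpha}e^{xt}=\sum_{n\ge0}B_n^{(\alpha)}(x)\frac{t^n}{n!}$. Convention: $(-\lambda)^0=1$. *)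

theory Defs
  imports Complex_Main "HOL-Computational_Algebra.Computational_Algebra"
begin

text \<open>
  A series with coefficients \<open>a\<^sub>k / k!\<close> acts on polynomials by \<open>x\<^sup>n \<mapsto> a\<^sub>n\<close>, and
  \<open>a\<^sub>n\<close> is \<open>n!\<close> times the coefficient of \<open>t\<^sup>n\<close> as stored in the type of formal power series.
\<close>

definition umbral :: "complex fps \<Rightarrow> complex poly \<Rightarrow> complex" where
  "umbral f p = (\<Sum>i\<le>degree p. coeff p i * (fact i * fps_nth f i))"

definition delta_series :: "complex fps \<Rightarrow> bool" where
  "delta_series f \<longleftrightarrow> fps_nth f 0 = 0 \<and> fps_nth f 1 \<noteq> 0"

definition invertible_series :: "complex fps \<Rightarrow> bool" where
  "invertible_series g \<longleftrightarrow> fps_nth g 0 \<noteq> 0"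

definition sheffer_seq :: "complex fps \<Rightarrow> complex fps \<Rightarrow> (nat \<Rightarrow> complex poly) \<Rightarrow> bool" where
  "sheffer_seq g f S \<longleftrightarrow> invertible_series g \<and> delta_series f \<and>
     (\<forall>n k. umbral (g * f ^ k) (S n) = (if n = k then fact n else 0))"

definition associated_seq :: "complex fps \<Rightarrow> (nat \<Rightarrow> complex poly) \<Rightarrow> bool" where
  "associated_seq f S \<longleftrightarrow> sheffer_seq 1 f S"

text \<open>
  The power \<open>F\<^sup>\<alpha>\<close> of a series \<open>F\<close> with constant term \<open>1\<close>, i.e. the binomial series
  \<open>(1 + u)\<^sup>\<alpha>\<close> at \<open>u = F - 1\<close>. For \<open>\<alpha> \<in> \<nat>\<close> it is the ordinary power.
\<close>

definition fps_cpow :: "complex fps \<Rightarrow> complex \<Rightarrow> complex fps" where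
  "fps_cpow F \<alpha> = fps_binomial \<alpha> oo (F - 1)"

text \<open>
  The generating function is an identity between power series in \<open>t\<close> whose coefficients are
  polynomials in \<open>x\<close>: \<open>fps_const_poly\<close> embeds series with constant coefficients, and
  \<open>fps_exp_xt\<close> is \<open>e\<^bsup>xt\<^esup>\<close>.
\<close>

definition fps_const_poly :: "complex fps \<Rightarrow> complex poly fps" where
  "fps_const_poly F = Abs_fps (\<lambda>n. [:fps_nth F n:])"

definition fps_exp_xt :: "complex poly fps" where
  "fps_exp_xt = Abs_fps (\<lambda>n. monom (1 / fact n) n)"

definition bernoulli_poly :: "complex \<Rightarrow> nat \<Rightarrow> complex poly" where
  "bernoulli_poly \<alpha> n = smult (fact n)
     (fps_nth (fps_const_poly (fps_cpow (fps_X / (fps_exp 1 - 1)) \<alpha>) * fps_exp_xt) n)"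

lemma umbral_alt:
  assumes "degree p \<le> n"
  shows "umbral f p = (\<Sum>i\<le>n. coeff p i * (fact i * fps_nth f i))"
  unfolding umbral_def
  by (rule sum.mono_neutral_left) (use assms in \<open>auto simp: coeff_eq_0\<close>)

lemma umbral_monom: "umbral f (monom 1 n) = fact n * fps_nth f n"
proof -
  have "umbral f (monom 1 n) = (\<Sum>i\<le>n. coeff (monom 1 n) i * (fact i * fps_nth f i))"
    by (rule umbral_alt) (simp add: degree_monom_le)
  also have "\<dots> = (\<Sum>i\<le>n. if i = n then fact n * fps_nth f n else 0)"
    by (rule sum.cong) auto
  finally show ?thesis by simp
qed

lemma umbral_add: "umbral f (p + q) = umbral f p + umbral f q"
proof -
  define n where "n = max (degree p) (degree q)"
  have "degree (p + q) \<le> n" "degree p \<le> n" "degree q \<le> n"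
    by (auto simp: n_def degree_add_le_max)
  then show ?thesis
    by (simp add: umbral_alt[of _ n] sum.distrib[symmetric] algebra_simps)
qed

lemma umbral_smult: "umbral f (smult c p) = c * umbral f p"
  by (simp add: umbral_alt[of "smult c p" "degree p"] umbral_alt[of p "degree p"]
      sum_distrib_left algebra_simps)

lemma umbral_diff: "umbral f (p - q) = umbral f p - umbral f q"
proof -
  have "p - q = p + smult (-1) q"
    by simp
  then show ?thesis
    by (simp only: umbral_add umbral_smult) simp
qed

lemma nth_delta_power:
  assumes "invertible_series g" "delta_series f"
  shows "i < k \<Longrightarrow> fps_nth (g * f ^ k) i = 0" "fps_nth (g * f ^ k) k \<noteq> 0"
proof -
  have sf: "subdegree f = 1"
    using assms(2) by (intro subdegreeI) (auto simp: delta_series_def)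
  have sg: "subdegree g = 0"
    using assms(1) by (intro subdegreeI) (auto simp: invertible_series_def)
  have nz: "f \<noteq> 0" "g \<noteq> 0"
    using assms by (auto simp: delta_series_def invertible_series_def)
  have s: "subdegree (g * f ^ k) = k"
    using sf sg nz by simp
  show "i < k \<Longrightarrow> fps_nth (g * f ^ k) i = 0"
    using s by (intro nth_less_subdegree_zero) simp
  show "fps_nth (g * f ^ k) k \<noteq> 0"
    using s nz nth_subdegree_nonzero[of "g * f ^ k"] by simp
qed

lemma umbral_eq_0_imp:
  assumes "invertible_series g" "delta_series f"
    and "\<And>k. umbral (g * f ^ k) p = 0"
  shows "p = 0"
proof (rule ccontr)
  assume p: "p \<noteq> 0"
  define d where "d = degree p"
  have "umbral (g * f ^ d) p =
      (\<Sum>i\<le>d. if i = d then coeff p d * (fact d * fps_nth (g * f ^ d) d) else 0)"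
    unfolding umbral_def d_def[symmetric]
    by (rule sum.cong) (auto simp: nth_delta_power(1)[OF assms(1,2)])
  then have "umbral (g * f ^ d) p = coeff p d * (fact d * fps_nth (g * f ^ d) d)"
    by simp
  then show False
    using assms(3)[of d] p nth_delta_power(2)[OF assms(1,2), of d] by (simp add: d_def)
qed

lemma umbral_prescribe:
  assumes "invertible_series g" "delta_series f"
  shows "\<exists>p. degree p \<le> n \<and> (\<forall>k\<le>n. umbral (g * f ^ k) p = c k)"
proof (induction n arbitrary: c)
  case 0
  have "fps_nth g 0 \<noteq> 0"
    using assms by (simp add: invertible_series_def)
  then show ?case
    by (intro exI[of _ "[:c 0 / fps_nth g 0:]"]) (simp add: umbral_def)
next
  case (Suc n)
  define A where "A k = umbral (g * f ^ k) (monom 1 (Suc n))" for k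
  define a where "a = c (Suc n) / A (Suc n)"
  have nz: "A (Suc n) \<noteq> 0"
    unfolding A_def umbral_monom
    using nth_delta_power(2)[OF assms, of "Suc n"] by (intro no_zero_divisors fact_nonzero)
  obtain p where p: "degree p \<le> n" "\<forall>k\<le>n. umbral (g * f ^ k) p = c k - a * A k"
    using Suc.IH[of "\<lambda>k. c k - a * A k"] by blast
  have top: "umbral (g * f ^ Suc n) p = 0"
    unfolding umbral_alt[OF p(1)]
    by (rule sum.neutral) (use nth_delta_power(1)[OF assms, of _ "Suc n"] in auto)
  define q where "q = p + smult a (monom 1 (Suc n))"
  have "degree q \<le> Suc n"
    unfolding q_def using p(1)
    by (intro degree_add_le order.trans[OF degree_smult_le] degree_monom_le) simp_all
  moreover have "umbral (g * f ^ k) q = c k" if "k \<le> Suc n" for k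
  proof (cases "k = Suc n")
    case True
    then show ?thesis
      using top nz by (simp only: q_def umbral_add umbral_smult A_def[symmetric]) (simp add: a_def)
  next
    case False
    then show ?thesis
      using p(2) that by (simp add: q_def umbral_add umbral_smult A_def[symmetric])
  qed
  ultimately show ?case by blast
qed

theorem sheffer_seq_ex1:
  assumes gf: "invertible_series g" "delta_series f"
  shows "\<exists>!S. sheffer_seq g f S"
proof -
  have "\<exists>p. \<forall>k. umbral (g * f ^ k) p = (if n = k then fact n else 0)" for n
  proof -
    obtain p where p: "degree p \<le> n"
        "\<forall>k\<le>n. umbral (g * f ^ k) p = (if n = k then fact n else 0)"
      using umbral_prescribe[OF gf, of n "\<lambda>k. if n = k then fact n else 0"] by blast
    have "umbral (g * f ^ k) p = 0" if "k > n" for k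
      unfolding umbral_alt[OF p(1)]
      by (rule sum.neutral) (use that nth_delta_power(1)[OF gf, of _ k] in auto)
    then show ?thesis
      using p(2) by (intro exI[of _ p]) (metis linorder_not_less order.strict_iff_not)
  qed
  then obtain S where S: "\<And>n k. umbral (g * f ^ k) (S n) = (if n = k then fact n else 0)"
    by metis
  show ?thesis
  proof (rule ex1I[of _ S])
    show "sheffer_seq g f S"
      using S gf by (simp add: sheffer_seq_def)
    fix T assume T: "sheffer_seq g f T"
    have "T n - S n = 0" for n
      by (rule umbral_eq_0_imp[OF gf]) (use T S in \<open>simp add: umbral_diff sheffer_seq_def\<close>)
    then show "T = S"
      by auto
  qed
qed

lemma fps_cpow_of_nat:
  assumes "fps_nth F 0 = 1"
  shows "fps_cpow F (of_nat n) = F ^ n"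
proof -
  have "fps_nth (F - 1) 0 = 0"
    using assms by simp
  then show ?thesis
    by (simp add: fps_cpow_def fps_binomial_of_nat fps_compose_power[symmetric]
        fps_compose_add_distrib)
qed

lemma bernoulli_base: "fps_X / (fps_exp 1 - 1 :: complex fps) * (fps_exp 1 - 1) = fps_X"
  and bernoulli_base_nth_0: "fps_nth (fps_X / (fps_exp 1 - 1 :: complex fps)) 0 = 1"
proof -
  let ?E = "fps_exp 1 - 1 :: complex fps"
  have s: "subdegree ?E = 1"
    by (intro subdegreeI) auto
  then have nz: "?E \<noteq> 0"
    by auto
  have "?E dvd fps_X"
    using s nz by (simp add: fps_dvd_iff)
  then show *: "fps_X / ?E * ?E = fps_X"
    by simp
  have "fps_nth (fps_X / ?E * ?E) 1 = fps_nth (fps_X / ?E) 0"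
    by (simp add: fps_mult_nth)
  then show "fps_nth (fps_X / ?E) 0 = 1"
    unfolding * by simp
qed

lemma poly_bernoulli_poly:
  "poly (bernoulli_poly \<alpha> n) x =
     fact n * fps_nth (fps_cpow (fps_X / (fps_exp 1 - 1)) \<alpha> * fps_exp x) n"
  by (simp add: bernoulli_poly_def fps_const_poly_def fps_exp_xt_def fps_mult_nth poly_sum
      poly_monom)

lemma delta_series_quotient:
  assumes "lam \<noteq> 1"
  shows "delta_series ((fps_exp 1 - 1) / (fps_exp 1 - fps_const lam))"
proof -
  let ?D = "fps_exp 1 - fps_const lam :: complex fps"
  have "fps_nth ?D 0 \<noteq> 0"
    using assms by simp
  then show ?thesis
    using assms by (simp add: delta_series_def fps_divide_unit fps_mult_nth)
qed

end

theory Submission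
  imports Defs
begin

text \<open>
  The proof is the transfer formula of the umbral calculus. Write the delta series
  \<open>f = (e\<^sup>t - 1) / (e\<^sup>t - \<lambda>)\<close> as \<open>t / u\<close>, so that \<open>u = t / (e\<^sup>t - 1) \<cdot> (e\<^sup>t - \<lambda>)\<close>. The associated sequence of \<open>f\<close> is
  \<open>x (u(t)\<^sup>n x\<^bsup>n-1\<^esup>)\<close>, a series acting on polynomials with \<open>t\<close> as differentiation
  (\<open>associated_seq_transfer\<close>). Expanding \<open>(e\<^sup>t - \<lambda>)\<^sup>n\<close> by the binomial theorem turns \<open>u\<^sup>n\<close> into a
  combination of the series \<open>(t / (e\<^sup>t - 1))\<^sup>n e\<^bsup>lt\<^esup>\<close>; the first factor sends \<open>x\<^bsup>n-1\<^esup>\<close> to the Bernoulli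
  polynomial of order \<open>n\<close>, and \<open>e\<^bsup>lt\<^esup>\<close> shifts its argument by \<open>l\<close>.

  The transfer formula itself is a form of Lagrange inversion. Multiplication by \<open>x\<close> is adjoint to
  differentiation of series, so pairing \<open>f\<^sup>k\<close> with the claimed polynomial gives \<open>(n-1)!\<close> times the
  coefficient of \<open>t\<^bsup>n-1\<^esup>\<close> in \<open>u\<^sup>n (f\<^sup>k)'\<close>. That coefficient is the residue of \<open>f\<^bsup>-n\<^esup> (f\<^sup>k)'\<close>: for
  \<open>k \<noteq> n\<close> this is a multiple of the derivative of a Laurent series and has residue \<open>0\<close>,
  and for \<open>k = n\<close> it is \<open>n\<close> times the logarithmic derivative of a series with a simple zero
  (\<open>lagrange_coefficient\<close>). Since the pairings with the powers of a delta series determine a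
  polynomial, the claim follows.
\<close>

section \<open>Lagrange inversion\<close>

text \<open>
  This is the residue of \<open>f\<^bsup>-n\<^esup> (f\<^sup>k)'\<close> for \<open>n = m + 1\<close>, computed without negative powers. For \<open>k > n\<close>
  the series \<open>(f\<^sup>k)'\<close> starts too late to contribute. For \<open>k < n\<close>, differentiating \<open>u\<^sup>k f\<^sup>k = t\<^sup>k\<close> and
  multiplying by \<open>u\<^sup>r\<close> with \<open>r = n - k\<close> leaves \<open>k/r (r t\<^bsup>k-1\<^esup> u\<^sup>r - t\<^sup>k (u\<^sup>r)')\<close>, where the two terms
  have the same coefficient of \<open>t\<^sup>m\<close>. For \<open>k = n\<close> the product rule gives
  \<open>n t\<^sup>m (1 - u' f)\<close>, and \<open>f\<close> has no constant term.
\<close>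

lemma lagrange_coefficient:
  fixes f u :: "complex fps"
  assumes uf: "u * f = fps_X" and f0: "fps_nth f 0 = 0"
  shows "fps_nth (u ^ Suc m * fps_deriv (f ^ k)) m = (if k = Suc m then of_nat (Suc m) else 0)"
proof -
  have prod_rule: "u ^ k * fps_deriv (f ^ k) = of_nat k * fps_X ^ (k - 1) - fps_deriv (u ^ k) * f ^ k"
  proof -
    have "fps_deriv (u ^ k * f ^ k) = of_nat k * fps_X ^ (k - 1)"
      by (simp add: power_mult_distrib[symmetric] uf fps_deriv_power fps_of_nat)
    then show ?thesis
      by (simp add: algebra_simps)
  qed
  consider "k = 0" | "k > Suc m" | "k = Suc m" | "0 < k" "k < Suc m"
    by linarith
  then show ?thesis
  proof cases
    case 1
    then show ?thesis
      by simp
  next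
    case 2
    have "fps_nth (f ^ k) i = 0" if "i < k" for i
      using that f0 by (simp add: startsby_zero_power_prefix)
    then show ?thesis
      using 2 by (simp add: fps_mult_nth)
  next
    case 3
    have "fps_deriv (u ^ k) * f ^ k = of_nat k * (fps_X ^ m * (fps_deriv u * f))"
      unfolding 3 fps_deriv_power fps_of_nat
      by (simp add: uf[symmetric] power_mult_distrib mult_ac del: of_nat_Suc)
    then have "u ^ Suc m * fps_deriv (f ^ k) =
        of_nat k * (fps_X ^ m * (1 - fps_deriv u * f))"
      using prod_rule 3 by (simp add: algebra_simps)
    then show ?thesis
      using 3 f0 by (simp add: fps_of_nat[symmetric] fps_X_power_mult_nth del: power_Suc of_nat_Suc)
  next
    case 4
    define r where "r = Suc m - k"
    have r: "r > 0" "Suc m = r + k" "m = (k - 1) + r" "m = k + (r - 1)"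
      using 4 by (auto simp: r_def)
    have "r + (k - 1) = (r - 1) + k"
      using r 4 by simp
    then have swap: "u ^ r * u ^ (k - 1) * f ^ k = u ^ (r - 1) * fps_X ^ k"
      by (simp add: power_add[symmetric] uf[symmetric] power_mult_distrib)
    have "u ^ r * (fps_deriv (u ^ k) * f ^ k) =
        of_nat k * fps_deriv u * (u ^ r * u ^ (k - 1) * f ^ k)"
      unfolding fps_deriv_power fps_of_nat by (simp only: mult_ac)
    then have U: "of_nat r * (u ^ r * (fps_deriv (u ^ k) * f ^ k)) =
        of_nat k * (fps_X ^ k * fps_deriv (u ^ r))"
      unfolding swap fps_deriv_power fps_of_nat by (simp only: mult_ac)
    have "of_nat r * (u ^ Suc m * fps_deriv (f ^ k)) =
        of_nat r * (u ^ r * (u ^ k * fps_deriv (f ^ k)))"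
      unfolding r(2) by (simp add: power_add algebra_simps)
    also have "\<dots> = of_nat k * (fps_X ^ (k - 1) * (of_nat r * u ^ r) - fps_X ^ k * fps_deriv (u ^ r))"
      unfolding prod_rule right_diff_distrib U by (simp add: algebra_simps)
    \<comment> \<open>Write the integer factors as constant series, so that coefficients can be read off.\<close>
    finally have eq: "fps_const (of_nat r) * (u ^ Suc m * fps_deriv (f ^ k)) =
        fps_const (of_nat k) *
          (fps_X ^ (k - 1) * (fps_const (of_nat r) * u ^ r) - fps_X ^ k * fps_deriv (u ^ r))"
      by (simp only: fps_of_nat)
    have "fps_nth (fps_X ^ (k - 1) * (fps_const (of_nat r) * u ^ r)) m = of_nat r * fps_nth (u ^ r) r"
      using r(3) by (simp add: fps_X_power_mult_nth)
    moreover have "fps_nth (fps_X ^ k * fps_deriv (u ^ r)) m = of_nat r * fps_nth (u ^ r) r"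
      using r(1,4) by (simp add: fps_X_power_mult_nth)
    ultimately have "of_nat r * fps_nth (u ^ Suc m * fps_deriv (f ^ k)) m = 0"
      using arg_cong[OF eq, of "\<lambda>F. fps_nth F m"] by (simp del: power_Suc)
    then show ?thesis
      using r(1) 4 by simp
  qed
qed

section \<open>The transfer formula\<close>

text \<open>
  The result of letting \<open>h(t)\<close> act on \<open>x\<^sup>m\<close> with \<open>t\<close> as differentiation; over all \<open>m\<close> these
  polynomials have the exponential generating function \<open>h(t) e\<^bsup>xt\<^esup>\<close>.
\<close>

definition appell_poly :: "complex fps \<Rightarrow> nat \<Rightarrow> complex poly" where
  "appell_poly h m = (\<Sum>j\<le>m. monom (fact m / fact j * fps_nth h (m - j)) j)"

lemma coeff_appell_poly:
  "coeff (appell_poly h m) j = (if j \<le> m then fact m / fact j * fps_nth h (m - j) else 0)"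
  by (simp add: appell_poly_def coeff_sum)

lemma poly_appell_poly: "poly (appell_poly h m) x = fact m * fps_nth (h * fps_exp x) m"
proof -
  have "poly (appell_poly h m) x = fact m * fps_nth (fps_exp x * h) m"
    unfolding appell_poly_def poly_sum poly_monom fps_mult_nth sum_distrib_left atMost_atLeast0
    by (rule sum.cong) simp_all
  then show ?thesis
    by (simp add: mult.commute)
qed

text \<open>
  Multiplication by \<open>x\<close> is adjoint to differentiation of series, and the action of \<open>h\<close> is adjoint to
  multiplication by \<open>h\<close>.
\<close>

lemma umbral_x_appell_poly:
  "umbral F (pCons 0 (appell_poly h m)) = fact m * fps_nth (h * fps_deriv F) m"
proof -
  have "degree (appell_poly h m) \<le> m"
    by (rule degree_le) (simp add: coeff_appell_poly)
  then have "degree (pCons 0 (appell_poly h m)) \<le> Suc m"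
    using degree_pCons_le[of 0 "appell_poly h m"] by linarith
  then have "umbral F (pCons 0 (appell_poly h m)) =
      (\<Sum>j\<le>m. coeff (appell_poly h m) j * (fact (Suc j) * fps_nth F (Suc j)))"
    by (simp add: umbral_alt[of _ "Suc m"] sum.atMost_Suc_shift del: fact_Suc sum.atMost_Suc)
  also have "\<dots> = (\<Sum>j\<le>m. fact m * (fps_nth (fps_deriv F) j * fps_nth h (m - j)))"
    by (rule sum.cong) (simp_all add: coeff_appell_poly field_simps)
  also have "\<dots> = fact m * fps_nth (fps_deriv F * h) m"
    by (simp add: fps_mult_nth sum_distrib_left atMost_atLeast0)
  finally show ?thesis
    by (simp add: mult.commute)
qed

text \<open>
  By the two preceding adjunctions, Lagrange inversion says that the right-hand side has the pairings
  with the powers of \<open>f\<close> that define the associated sequence, and these determine a polynomial.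
\<close>

lemma associated_seq_transfer:
  assumes M: "associated_seq f M" and uf: "u * f = fps_X"
  shows "M (Suc m) = pCons 0 (appell_poly (u ^ Suc m) m)"
proof -
  let ?p = "pCons 0 (appell_poly (u ^ Suc m) m)"
  have inv: "invertible_series 1" and delta: "delta_series f"
    and pair: "\<And>k. umbral (f ^ k) (M (Suc m)) = (if Suc m = k then fact (Suc m) else 0)"
    using M by (auto simp: associated_seq_def sheffer_seq_def)
  have "umbral (f ^ k) ?p = (if Suc m = k then fact (Suc m) else 0)" for k
    using delta unfolding umbral_x_appell_poly
    by (subst lagrange_coefficient[OF uf]) (auto simp: delta_series_def)
  then have "M (Suc m) - ?p = 0"
    by (intro umbral_eq_0_imp[OF inv delta]) (simp add: umbral_diff pair)
  then show ?thesis
    by simp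
qed

section \<open>The series \<open>(e\<^sup>t - 1) / (e\<^sup>t - \<lambda>)\<close>\<close>

lemma power_exp_minus_const:
  "(fps_exp 1 - fps_const lam :: complex fps) ^ n =
     (\<Sum>l\<le>n. fps_const (of_nat (n choose l) * (- lam) ^ (n - l)) * fps_exp (of_nat l))"
proof -
  have "(fps_exp 1 - fps_const lam :: complex fps) ^ n = (fps_exp 1 + fps_const (- lam)) ^ n"
    by (simp flip: fps_const_neg)
  then show ?thesis
    by (simp add: binomial_ring fps_exp_power_mult fps_const_power fps_of_nat[symmetric]
        mult_ac flip: fps_const_mult)
qed

theorem theorem6:
  fixes lam :: complex and M :: "nat \<Rightarrow> complex poly" and n :: nat and x :: complex
  assumes "lam \<noteq> 1"
    and "associated_seq ((fps_exp 1 - 1) / (fps_exp 1 - fps_const lam)) M"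
    and "n \<ge> 1"
  shows "poly (M n) x =
    (\<Sum>l=0..n. of_nat (n choose l) * (- lam) ^ (n - l) *
       x * poly (bernoulli_poly (of_nat n) (n - 1)) (x + of_nat l))"
proof -
  define B :: "complex fps" where "B = fps_X / (fps_exp 1 - 1)"
  define D :: "complex fps" where "D = fps_exp 1 - fps_const lam"
  define m where "m = n - 1"
  have n: "n = Suc m"
    using assms(3) by (simp add: m_def)
  have D0: "fps_nth D 0 \<noteq> 0"
    using assms(1) by (simp add: D_def)
  have "B * D * ((fps_exp 1 - 1) / D) = B * (fps_exp 1 - 1) * (D * inverse D)"
    using D0 by (simp add: fps_divide_unit mult_ac)
  also have "\<dots> = fps_X"
    using D0 by (simp add: B_def bernoulli_base inverse_mult_eq_1')
  finally have u: "B * D * ((fps_exp 1 - 1) / D) = fps_X" .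
  have shift: "poly (bernoulli_poly (of_nat n) m) (x + of_nat l) =
      fact m * fps_nth (B ^ n * fps_exp (of_nat l) * fps_exp x) m" for l
    using fps_cpow_of_nat[OF bernoulli_base_nth_0]
    by (simp add: poly_bernoulli_poly B_def fps_exp_add_mult mult_ac)
  have expand: "(B * D) ^ n * fps_exp x =
      (\<Sum>l\<le>n. fps_const (of_nat (n choose l) * (- lam) ^ (n - l)) *
         (B ^ n * fps_exp (of_nat l) * fps_exp x))"
    unfolding power_mult_distrib D_def power_exp_minus_const
    by (simp add: sum_distrib_left sum_distrib_right mult_ac)
  have "poly (M n) x = x * (fact m * fps_nth ((B * D) ^ n * fps_exp x) m)"
    using associated_seq_transfer[OF assms(2)[folded D_def] u, of m]
    by (simp add: n poly_appell_poly del: power_Suc)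
  also have "\<dots> = (\<Sum>l\<le>n. of_nat (n choose l) * (- lam) ^ (n - l) * x *
      (fact m * fps_nth (B ^ n * fps_exp (of_nat l) * fps_exp x) m))"
    unfolding expand fps_sum_nth fps_mult_left_const_nth sum_distrib_left
    by (rule sum.cong) (simp_all only: mult_ac)
  finally show ?thesis
    by (simp only: shift m_def[symmetric] atMost_atLeast0)
qed

end
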